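(* Let $k\geq 100$ be an odd integer. Let $G$ be a graph on $n$ vertices with $g_{\text{odd}}\geq k$. If $\lambda_1\geq n/k^3$, then $$\frac{\lambda_1+\lambda_n}{n}\leq \frac{4}{k^2}\cdot\frac{\lambda_1}{n}\left(\log\left(\frac{2n}{\lambda_1}\right)\right)^2.$$
   Context: All graphs are finite and simple. For a graph $G$ on $n\ge 1$ vertices, $\lambda_1\geq\dots\geq\lambda_n$ denote the eigenvalues (with multiplicity) of its adjacency matrix $A(G)$. The odd girth $g_{\text{odd}}$ of $G$ is the length of the shortest odd cycle in $G$, with $g_{\text{odd}}=\infty$ if $G$ has no odd cycles. $\log$ is the natural logarithm. *)

theory Defs
  imports
    Complex_Main
    "HOL-Library.Extended_Nat"
    "Graph_Theory.Arc_Walk"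
    "Jordan_Normal_Form.Char_Poly"
begin

text \<open>
  Finite simple graphs are the symmetric, loop-free digraphs without parallel arcs of
  \<^locale>\<open>graph\<close>: an edge between \<open>u\<close> and \<open>v\<close> is the pair of arcs \<open>(u,v)\<close> and \<open>(v,u)\<close>.
  The rows and columns of the adjacency matrix follow an enumeration \<open>vs\<close> of the vertices.
\<close>

definition adjacency_matrix :: "('a, 'b) pre_digraph \<Rightarrow> 'a list \<Rightarrow> real mat" where
  "adjacency_matrix G vs =
     mat (length vs) (length vs) (\<lambda>(i, j). if (vs ! i, vs ! j) \<in> arcs_ends G then 1 else 0)"

text \<open>
  The real eigenvalues of a square matrix in decreasing order, each repeated according to its
  multiplicity as a root of the characteristic polynomial. For an \<open>n \<times> n\<close> matrix the list can
  be shorter than \<open>n\<close> in general, but not if the matrix is symmetric; see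
  \<open>length_eigenvalues_desc\<close>.
\<close>

definition eigenvalues_desc :: "real mat \<Rightarrow> real list" where
  "eigenvalues_desc A = rev (sorted_list_of_multiset (proots (char_poly A)))"

text \<open>The index \<open>i\<close> counts from 1, so that \<open>graph_eigenvalue G vs 1\<close> is the largest eigenvalue.\<close>

definition graph_eigenvalue :: "('a, 'b) pre_digraph \<Rightarrow> 'a list \<Rightarrow> nat \<Rightarrow> real" where
  "graph_eigenvalue G vs i = eigenvalues_desc (adjacency_matrix G vs) ! (i - 1)"

text \<open>
  In a symmetric digraph, \<^const>\<open>pre_digraph.cycle\<close> also accepts the closed walks \<open>u, v, u\<close> of
  length 2, which are not cycles of the undirected graph. They have even length, so the
  odd cycles are the usual ones. The infimum of the empty set is \<open>\<infinity>\<close>.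
\<close>

definition odd_girth :: "('a, 'b) pre_digraph \<Rightarrow> enat" where
  "odd_girth G = (INF p \<in> {p. pre_digraph.cycle G p \<and> odd (length p)}. enat (length p))"

lemma symmetric_real_mat_char_poly_factorized:
  fixes A :: "real mat"
  assumes A: "A \<in> carrier_mat n n" and sym: "A\<^sup>T = A"
  shows "\<exists>as. char_poly A = (\<Prod>a\<leftarrow>as. [:- a, 1:]) \<and> length as = n"
proof -
  let ?B = "map_mat complex_of_real A"
  have B: "?B \<in> carrier_mat n n" using A by auto
  have cB: "char_poly ?B = map_poly complex_of_real (char_poly A)"
    by (rule of_real_hom.char_poly_hom[OF A])
  obtain cs where cs: "char_poly ?B = (\<Prod>a\<leftarrow>cs. [:- a, 1:])" and len: "length cs = n"
    using char_poly_factorized[OF B] by auto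
  have real: "c \<in> \<real>" if "c \<in> set cs" for c
  proof -
    have "poly (char_poly ?B) c = 0"
      using that unfolding cs by (auto simp: poly_prod_list prod_list_zero_iff)
    then obtain v where "eigenvector ?B v c"
      using eigenvalue_root_char_poly[OF B] unfolding eigenvalue_def by auto
    then have v: "v \<in> carrier_vec n" and v0: "v \<noteq> 0\<^sub>v n" and ev: "?B *\<^sub>v v = c \<cdot>\<^sub>v v"
      using B unfolding eigenvector_def by auto
    have row: "(\<Sum>j<n. of_real (A $$ (i, j)) * v $ j) = c * v $ i" if "i < n" for i
    proof -
      have "(?B *\<^sub>v v) $ i = (\<Sum>j<n. of_real (A $$ (i, j)) * v $ j)"
        using that A v by (simp add: scalar_prod_def lessThan_atLeast0)
      then show ?thesis using that v unfolding ev by simp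
    qed
    have symA: "A $$ (i, j) = A $$ (j, i)" if "i < n" "j < n" for i j
      using that A sym by (metis carrier_matD index_transpose_mat(1))
    define q where "q = (\<Sum>i<n. cnj (v $ i) * (\<Sum>j<n. of_real (A $$ (i, j)) * v $ j))"
    define s where "s = (\<Sum>i<n. (cmod (v $ i))\<^sup>2)"
    have q1: "q = c * of_real s"
      unfolding q_def s_def of_real_sum sum_distrib_left[where r = c]
    proof (intro sum.cong refl)
      fix i assume "i \<in> {..<n}"
      then have i: "i < n" by simp
      show "cnj (v $ i) * (\<Sum>j<n. of_real (A $$ (i, j)) * v $ j) = c * of_real ((cmod (v $ i))\<^sup>2)"
        unfolding row[OF i] complex_norm_square by (simp only: mult_ac)
    qed
    have "cnj q = (\<Sum>i<n. \<Sum>j<n. v $ i * (of_real (A $$ (i, j)) * cnj (v $ j)))"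
      unfolding q_def by (simp add: sum_distrib_left)
    also have "\<dots> = (\<Sum>j<n. \<Sum>i<n. v $ i * (of_real (A $$ (i, j)) * cnj (v $ j)))"
      by (rule sum.swap)
    also have "\<dots> = q"
      unfolding q_def sum_distrib_left
      by (intro sum.cong refl) (simp add: symA)
    finally have "cnj q = q" .
    moreover have "s \<noteq> 0"
    proof
      assume "s = 0"
      then have "\<forall>i<n. v $ i = 0"
        unfolding s_def by (subst (asm) sum_nonneg_eq_0_iff) auto
      then have "v = 0\<^sub>v n" using v by (intro eq_vecI) auto
      with v0 show False by simp
    qed
    ultimately have "cnj c = c" unfolding q1 by simp
    then show ?thesis by (simp add: Reals_cnj_iff)
  qed
  define rs where "rs = map Re cs"
  have csrs: "cs = map complex_of_real rs"
    unfolding rs_def using real by (simp add: map_idI)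
  have "map_poly complex_of_real (char_poly A) = map_poly complex_of_real (\<Prod>a\<leftarrow>rs. [:- a, 1:])"
  proof -
    interpret hp: map_poly_inj_comm_ring_hom complex_of_real ..
    show ?thesis
      unfolding cB[symmetric] cs csrs by (simp add: hp.hom_prod_list o_def)
  qed
  then have "char_poly A = (\<Prod>a\<leftarrow>rs. [:- a, 1:])"
    by (metis (no_types, lifting) coeff_map_poly of_real_0 of_real_eq_iff poly_eqI)
  then show ?thesis using len unfolding rs_def by (metis length_map)
qed

lemma length_eigenvalues_desc:
  assumes "A \<in> carrier_mat n n" and "A\<^sup>T = A"
  shows "length (eigenvalues_desc A) = n"
proof -
  obtain as where *: "char_poly A = (\<Prod>a\<leftarrow>as. [:- a, 1:])" "length as = n"
    using symmetric_real_mat_char_poly_factorized[OF assms] by blast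
  have "proots (\<Prod>a\<leftarrow>as. [:- a, 1:]) = mset as"
  proof (induction as)
    case (Cons a as)
    have "(\<Prod>a\<leftarrow>as. [:- a, 1:]) \<noteq> 0" by (auto simp: prod_list_zero_iff)
    then show ?case using Cons by (simp add: proots_mult del: mult_pCons_left)
  qed simp
  then have "mset (eigenvalues_desc A) = mset as"
    by (simp add: eigenvalues_desc_def *(1))
  then show ?thesis using *(2) by (metis size_mset)
qed

lemma (in graph) length_eigenvalues_adjacency_matrix:
  "length (eigenvalues_desc (adjacency_matrix G vs)) = length vs"
proof (rule length_eigenvalues_desc)
  show "(adjacency_matrix G vs)\<^sup>T = adjacency_matrix G vs"
    using arcs_ends_symmetric[OF sym_arcs]
    by (intro eq_matI) (auto simp: adjacency_matrix_def)
qed (simp add: adjacency_matrix_def)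

end

theory Submission
  imports
    Defs
    "HOL-Analysis.Convex"
    "Jordan_Normal_Form.Schur_Decomposition"
begin

text \<open>
  Write \<open>x\<^sub>0 \<ge> \<dots> \<ge> x\<^sub>n\<^sub>-\<^sub>1\<close> for the eigenvalues of the adjacency matrix \<open>A\<close>, \<open>a = x\<^sub>0\<close> and
  \<open>b = - x\<^sub>n\<^sub>-\<^sub>1\<close>. The trace of \<open>A\<^sup>l\<close> is the power sum of the \<open>x\<^sub>i\<close> of exponent \<open>l\<close>, and it counts
  closed walks of length \<open>l\<close>. A closed walk of odd length contains an odd cycle that is no longer
  (\<open>odd_closed_awalk_imp_odd_cycle\<close>), so the power sums with odd \<open>l < k\<close> all vanish
  (\<open>mat_trace_adjacency_matrix_odd_pow\<close>). Hence \<open>p x\<^sub>0 + \<dots> + p x\<^sub>n\<^sub>-\<^sub>1 = 0\<close> for every odd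
  polynomial \<open>p\<close> of degree below \<open>k\<close>.

  Apply this to \<open>p x = x\<^sup>2 T\<^sub>m (x / b)\<close>, where \<open>T\<^sub>m\<close> is the Chebyshev polynomial of odd degree
  \<open>m = k - 4\<close>. On \<open>[-b, \<infinity>)\<close>, where all eigenvalues lie, \<open>T\<^sub>m (x / b)\<close> is at least \<open>-1\<close>, so that
  \<open>a\<^sup>2 T\<^sub>m (a / b)\<close> is at most the sum of all \<open>x\<^sub>i\<^sup>2\<close> (\<open>chebyshev_le_of_odd_power_sums\<close>). The weight
  \<open>x\<^sup>2\<close> is what brings \<open>n / a\<close> into the bound: the sum of the \<open>x\<^sub>i\<^sup>2\<close> is the trace of \<open>A\<^sup>2\<close>, which is
  the sum of the entries of \<open>A\<close>, and this is at most \<open>n a\<close> (\<open>entry_sum_le\<close>). Therefore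
  \<open>T\<^sub>m (a / b) \<le> n / a\<close>.

  If \<open>b > a\<close>, the claim is trivial. Otherwise \<open>a / b = cosh u\<close> with \<open>u \<ge> 0\<close>, and
  \<open>T\<^sub>m (cosh u) = cosh (m u) \<ge> exp (m u) / 2\<close> shows that \<open>u \<le> ln (2 n / a) / m\<close>. Since
  \<open>1 - 1 / cosh u \<le> u\<^sup>2\<close>, this gives \<open>a - b \<le> a (ln (2 n / a) / m)\<^sup>2\<close> (\<open>gap_le_of_chebyshev_le\<close>),
  and \<open>k \<le> 2 m\<close> turns \<open>1 / m\<^sup>2\<close> into \<open>4 / k\<^sup>2\<close>.
\<close>

section \<open>Chebyshev polynomials\<close>

fun chebyshev :: "nat \<Rightarrow> real \<Rightarrow> real" where
  "chebyshev 0 x = 1"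
| "chebyshev (Suc 0) x = x"
| "chebyshev (Suc (Suc m)) x = 2 * x * chebyshev (Suc m) x - chebyshev m x"

lemma chebyshev_cos: "chebyshev m (cos t) = cos (real m * t)"
proof (induction m rule: induct_nat_012)
  case (ge2 m)
  have "cos (real (Suc m) * t + t) + cos (real (Suc m) * t - t) = 2 * cos t * cos (real (Suc m) * t)"
    by (simp add: cos_add cos_diff)
  then show ?case using ge2 by (simp add: algebra_simps)
qed simp_all

lemma chebyshev_cosh: "chebyshev m (cosh t) = cosh (real m * t)"
proof (induction m rule: induct_nat_012)
  case (ge2 m)
  have "cosh (real (Suc m) * t + t) + cosh (real (Suc m) * t - t) = 2 * cosh t * cosh (real (Suc m) * t)"
    by (simp add: cosh_add cosh_diff)
  then show ?case using ge2 by (simp add: algebra_simps)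
qed simp_all

lemma chebyshev_ge_minus_one:
  assumes "x \<ge> -1"
  shows "chebyshev m x \<ge> -1"
proof (cases "x \<le> 1")
  case True
  then have "chebyshev m x = cos (real m * arccos x)"
    using chebyshev_cos[of m "arccos x"] assms by simp
  then show ?thesis by simp
next
  case False
  then have "chebyshev m x = cosh (real m * arcosh x)"
    using chebyshev_cosh[of m "arcosh x"] by simp
  then show ?thesis using cosh_real_ge_1[of "real m * arcosh x"] by linarith
qed

text \<open>
  With \<open>y = exp (- u)\<close> the left-hand side is \<open>(1 - y)\<^sup>2 / (2 y)\<close>, where \<open>1 - y \<le> u\<close>, and
  \<open>1 / (2 y)\<close> is the larger of the two summands of \<open>cosh u\<close>.
\<close>

lemma cosh_minus_one_le:
  fixes u :: real
  assumes "u \<ge> 0"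
  shows "cosh u - 1 \<le> u\<^sup>2 * cosh u"
proof -
  define y where "y = exp (- u)"
  have y: "0 < y" "y \<le> 1" "1 - y \<le> u"
    using assms exp_ge_add_one_self[of "-u"] by (auto simp: y_def)
  have c: "cosh u = (1 / y + y) / 2"
    by (simp add: y_def cosh_field_def exp_minus field_simps)
  have "cosh u - 1 = (1 - y)\<^sup>2 / (2 * y)"
    using y(1) unfolding c by (simp add: field_simps power2_eq_square)
  also have "\<dots> \<le> u\<^sup>2 / (2 * y)"
    using y by (intro divide_right_mono power_mono) auto
  also have "\<dots> = u\<^sup>2 * (1 / y / 2)" by simp
  also have "\<dots> \<le> u\<^sup>2 * cosh u"
    unfolding c using y(1) by (intro mult_left_mono) (auto simp: field_simps)
  finally show ?thesis .
qed

text \<open>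
  To the right of \<open>1\<close> the polynomial of degree \<open>m\<close> grows like \<open>exp (m u)\<close> at \<open>cosh u\<close>. A bound on its
  value at \<open>a / b\<close> thus makes \<open>arcosh (a / b)\<close> small, of order \<open>1 / m\<close>, and the relative gap is
  quadratic in that number.
\<close>

lemma gap_le_of_chebyshev_le:
  assumes b: "0 < b" "b \<le> a" and m: "m > 0" and le: "chebyshev m (a / b) \<le> N"
  shows "a - b \<le> a * (ln (2 * N) / real m)\<^sup>2"
proof -
  define u where "u = arcosh (a / b)"
  have ab: "a / b \<ge> 1" using b by simp
  have u: "u \<ge> 0" "cosh u = a / b" using ab by (auto simp: u_def)
  have "exp (real m * u) \<le> 2 * cosh (real m * u)"
    by (simp add: cosh_field_def)
  also have "cosh (real m * u) = chebyshev m (a / b)"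
    using chebyshev_cosh[of m u] u by simp
  finally have e: "exp (real m * u) \<le> 2 * N" using le by simp
  then have "2 * N > 0" using exp_gt_zero[of "real m * u"] by linarith
  then have "real m * u \<le> ln (2 * N)" using e by (simp add: ln_ge_iff)
  then have "u \<le> ln (2 * N) / real m" using m by (simp add: field_simps)
  then have "u\<^sup>2 \<le> (ln (2 * N) / real m)\<^sup>2" using u(1) by (intro power_mono)
  then have "a * u\<^sup>2 \<le> a * (ln (2 * N) / real m)\<^sup>2" using b by (intro mult_left_mono) auto
  moreover have "a - b \<le> a * u\<^sup>2"
  proof -
    have "b * (a / b - 1) \<le> b * (u\<^sup>2 * (a / b))"
      using cosh_minus_one_le[OF u(1)] b unfolding u(2) by (intro mult_left_mono) auto
    then show ?thesis using b by (simp add: algebra_simps)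
  qed
  ultimately show ?thesis by linarith
qed

section \<open>Sequences whose odd power sums vanish\<close>

text \<open>
  For odd \<open>j + m\<close> the polynomial \<open>x\<^sup>j T\<^sub>m (x / b)\<close> is odd of degree \<open>j + m\<close>, hence a combination of
  odd powers. The additional factor \<open>x\<^sup>j\<close> lets the three-term recursion for \<open>T\<^sub>m\<close> serve as the induction step, since
  the factor \<open>x\<close> in front of \<open>T\<^sub>m\<^sub>+\<^sub>1\<close> only raises \<open>j\<close>; coefficients never appear.
\<close>

lemma chebyshev_sum_eq_0:
  fixes x :: "nat \<Rightarrow> real"
  assumes "\<And>l. odd l \<Longrightarrow> l \<le> M \<Longrightarrow> (\<Sum>i<n. x i ^ l) = 0"
    and "odd (j + m)" "j + m \<le> M"
  shows "(\<Sum>i<n. x i ^ j * chebyshev m (x i / b)) = 0"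
  using assms(2,3)
proof (induction m arbitrary: j rule: induct_nat_012)
  case 0
  then show ?case using assms(1) by simp
next
  case 1
  have "(\<Sum>i<n. x i ^ j * chebyshev (Suc 0) (x i / b)) = (\<Sum>i<n. x i ^ Suc j) / b"
    by (simp add: sum_divide_distrib mult.commute)
  then show ?case using assms(1)[of "Suc j"] 1 by simp
next
  case (ge2 m)
  have "(\<Sum>i<n. x i ^ j * chebyshev (Suc (Suc m)) (x i / b))
      = 2 / b * (\<Sum>i<n. x i ^ Suc j * chebyshev (Suc m) (x i / b))
        - (\<Sum>i<n. x i ^ j * chebyshev m (x i / b))"
    by (simp add: sum_distrib_left flip: sum_subtractf) (simp add: algebra_simps)
  also have "\<dots> = 0" using ge2.IH(1)[of j] ge2.IH(2)[of "Suc j"] ge2.prems by simp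
  finally show ?case .
qed

text \<open>
  In the vanishing sum of the \<open>x\<^sub>i\<^sup>2 T\<^sub>m (x\<^sub>i / b)\<close> no term is below \<open>- x\<^sub>i\<^sup>2\<close>, so the term of index
  \<open>0\<close> can only be as large as the other squares together.
\<close>

lemma chebyshev_le_of_odd_power_sums:
  fixes x :: "nat \<Rightarrow> real"
  assumes odd_sums: "\<And>l. odd l \<Longrightarrow> l \<le> m + 2 \<Longrightarrow> (\<Sum>i<n. x i ^ l) = 0"
    and "odd m" and b: "b > 0" and low: "\<And>i. i < n \<Longrightarrow> - b \<le> x i"
    and n: "n > 0" and x0: "x 0 > 0" and squares: "(\<Sum>i<n. (x i)\<^sup>2) \<le> N * x 0"
  shows "chebyshev m (x 0 / b) \<le> N / x 0"
proof -
  let ?T = "\<lambda>i. chebyshev m (x i / b)"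
  have "0 = (\<Sum>i<n. (x i)\<^sup>2 * ?T i)"
    using chebyshev_sum_eq_0[of "m + 2" x n 2 m b] odd_sums \<open>odd m\<close> by simp
  also have "\<dots> = (x 0)\<^sup>2 * ?T 0 + (\<Sum>i\<in>{..<n} - {0}. (x i)\<^sup>2 * ?T i)"
    using n by (simp add: sum.remove)
  also have "\<dots> \<ge> (x 0)\<^sup>2 * ?T 0 + (\<Sum>i\<in>{..<n} - {0}. - (x i)\<^sup>2)"
  proof (intro add_left_mono sum_mono)
    fix i assume "i \<in> {..<n} - {0}"
    then have "- 1 \<le> x i / b" using low[of i] b by (simp add: field_simps)
    then have "(x i)\<^sup>2 * - 1 \<le> (x i)\<^sup>2 * ?T i"
      by (intro mult_left_mono chebyshev_ge_minus_one) auto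
    then show "- (x i)\<^sup>2 \<le> (x i)\<^sup>2 * ?T i" by simp
  qed
  finally have "(x 0)\<^sup>2 * ?T 0 \<le> (\<Sum>i\<in>{..<n} - {0}. (x i)\<^sup>2)" by (simp add: sum_negf)
  also have "\<dots> \<le> (\<Sum>i<n. (x i)\<^sup>2)" by (intro sum_mono2) auto
  finally have "(x 0)\<^sup>2 * ?T 0 \<le> N * x 0" using squares by linarith
  then have "x 0 * (x 0 * ?T 0) \<le> x 0 * N" by (simp add: power2_eq_square mult_ac)
  then have "x 0 * ?T 0 \<le> N" using x0 by simp
  then show ?thesis using x0 by (simp add: field_simps)
qed

section \<open>Traces of matrix powers\<close>

definition mat_trace :: "'a :: comm_monoid_add mat \<Rightarrow> 'a" where
  "mat_trace A = (\<Sum>i<dim_row A. A $$ (i, i))"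

lemma index_mult_mat_sum:
  assumes "A \<in> carrier_mat n n" "B \<in> carrier_mat n n" "i < n" "j < n"
  shows "(A * B) $$ (i, j) = (\<Sum>k<n. A $$ (i, k) * B $$ (k, j))"
  using assms by (simp add: scalar_prod_def lessThan_atLeast0)

lemma mat_trace_mult_commute:
  fixes A B :: "'a :: comm_semiring_0 mat"
  assumes "A \<in> carrier_mat n n" "B \<in> carrier_mat n n"
  shows "mat_trace (A * B) = mat_trace (B * A)"
proof -
  have "mat_trace (A * B) = (\<Sum>i<n. \<Sum>k<n. A $$ (i, k) * B $$ (k, i))"
    using assms by (simp add: mat_trace_def index_mult_mat_sum[OF assms] del: index_mult_mat(1))
  also have "\<dots> = (\<Sum>k<n. \<Sum>i<n. B $$ (k, i) * A $$ (i, k))"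
    by (subst sum.swap) (simp add: mult.commute)
  also have "\<dots> = mat_trace (B * A)"
    using assms by (simp add: mat_trace_def index_mult_mat_sum[OF assms(2,1)] del: index_mult_mat(1))
  finally show ?thesis .
qed

lemma mat_trace_similar:
  fixes A :: "'a :: comm_ring_1 mat"
  assumes A: "A \<in> carrier_mat n n" and sim: "similar_mat_wit A B P Q"
  shows "mat_trace A = mat_trace B"
proof -
  note d = similar_mat_witD2[OF A sim]
  have "mat_trace A = mat_trace (P * (B * Q))" using d by simp
  also have "\<dots> = mat_trace ((B * Q) * P)" using d by (intro mat_trace_mult_commute) auto
  also have "(B * Q) * P = B * (Q * P)" using d by (intro assoc_mult_mat) auto
  also have "\<dots> = B" using d by simp
  finally show ?thesis .
qed

lemma upper_triangular_pow:
  fixes B :: "'a :: comm_semiring_1 mat"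
  assumes B: "B \<in> carrier_mat n n" and ut: "upper_triangular B"
  shows "i < n \<Longrightarrow> j \<le> i \<Longrightarrow> (B ^\<^sub>m l) $$ (i, j) = (if i = j then (B $$ (i, i)) ^ l else 0)"
proof (induction l arbitrary: i j)
  case 0
  then show ?case using B by simp
next
  case (Suc l)
  have "(B ^\<^sub>m Suc l) $$ (i, j) = (\<Sum>k<n. (B ^\<^sub>m l) $$ (i, k) * B $$ (k, j))"
    using B Suc.prems by (simp add: index_mult_mat_sum[of _ n] del: index_mult_mat(1))
  also have "\<dots> = (\<Sum>k<n. if k = j then (B ^\<^sub>m l) $$ (i, j) * B $$ (j, j) else 0)"
  proof (intro sum.cong refl)
    fix k assume "k \<in> {..<n}"
    then show "(B ^\<^sub>m l) $$ (i, k) * B $$ (k, j)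
        = (if k = j then (B ^\<^sub>m l) $$ (i, j) * B $$ (j, j) else 0)"
      using Suc.IH[of i k] Suc.prems upper_triangularD[OF ut, of j k] B
      by (cases k j rule: linorder_cases) auto
  qed
  also have "\<dots> = (B ^\<^sub>m l) $$ (i, j) * B $$ (j, j)" using Suc.prems by simp
  finally show ?case using Suc.IH[of i j] Suc.prems by (auto simp: mult.commute)
qed

text \<open>
  By Schur's decomposition \<open>A\<close> is similar to a triangular matrix whose diagonal lists the
  eigenvalues, and powers of triangular matrices have the powered diagonal.
\<close>

lemma mat_trace_pow:
  fixes A :: "'a :: conjugatable_ordered_field mat"
  assumes A: "A \<in> carrier_mat n n" and cp: "char_poly A = (\<Prod>e\<leftarrow>es. [:- e, 1:])"
  shows "mat_trace (A ^\<^sub>m l) = (\<Sum>e\<leftarrow>es. e ^ l)"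
proof -
  obtain B P Q where s: "schur_decomposition A es = (B, P, Q)" by (metis prod_cases3)
  have sim: "similar_mat_wit A B P Q" and ut: "upper_triangular B" and diag: "diag_mat B = es"
    using schur_decomposition[OF A cp s] by auto
  have B: "B \<in> carrier_mat n n" using similar_mat_witD2[OF A sim] by auto
  have "mat_trace (A ^\<^sub>m l) = mat_trace (B ^\<^sub>m l)"
    using A by (intro mat_trace_similar[OF _ similar_mat_wit_pow[OF sim]]) auto
  also have "\<dots> = (\<Sum>i<n. (B $$ (i, i)) ^ l)"
    using B by (simp add: mat_trace_def upper_triangular_pow[OF B ut])
  also have "\<dots> = (\<Sum>e\<leftarrow>diag_mat B. e ^ l)"
    using B by (simp add: diag_mat_def o_def interv_sum_list_conv_sum_set_nat lessThan_atLeast0)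
  finally show ?thesis unfolding diag .
qed

lemma mat_trace_pow_eigenvalues_desc:
  fixes A :: "real mat"
  assumes A: "A \<in> carrier_mat n n" and sym: "A\<^sup>T = A"
  shows "mat_trace (A ^\<^sub>m l) = (\<Sum>i<n. (eigenvalues_desc A ! i) ^ l)"
proof -
  obtain es where cp: "char_poly A = (\<Prod>e\<leftarrow>es. [:- e, 1:])"
    using symmetric_real_mat_char_poly_factorized[OF A sym] by blast
  have "proots (\<Prod>e\<leftarrow>es. [:- e, 1:]) = mset es"
  proof (induction es)
    case (Cons e es)
    have "(\<Prod>a\<leftarrow>es. [:- a, 1:]) \<noteq> 0" by (auto simp: prod_list_zero_iff)
    then show ?case using Cons by (simp add: proots_mult del: mult_pCons_left)
  qed simp
  then have "mset (eigenvalues_desc A) = mset es" by (simp add: eigenvalues_desc_def cp)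
  then have "(\<Sum>e\<leftarrow>es. e ^ l) = (\<Sum>e\<leftarrow>eigenvalues_desc A. e ^ l)"
    by (metis mset_map sum_mset_sum_list)
  also have "\<dots> = (\<Sum>i<n. (eigenvalues_desc A ! i) ^ l)"
    using length_eigenvalues_desc[OF A sym] by (simp add: sum_list_sum_nth lessThan_atLeast0)
  finally show ?thesis using mat_trace_pow[OF A cp] by simp
qed

section \<open>The sum of the entries of a symmetric matrix\<close>

definition entry_sum :: "real mat \<Rightarrow> real" where
  "entry_sum A = (\<Sum>i<dim_row A. \<Sum>j<dim_col A. A $$ (i, j))"

text \<open>
  Both bounds are instances of the Cauchy--Schwarz inequality: for symmetric \<open>B\<close> the entry sum of
  \<open>B\<^sup>2\<close> is the sum of the squared row sums, and the trace of \<open>B\<^sup>2\<close> is the sum of the squared entries.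
\<close>

lemma entry_sum_square_le:
  assumes B: "B \<in> carrier_mat n n" and sym: "B\<^sup>T = B"
  shows "(entry_sum B)\<^sup>2 \<le> real n * entry_sum (B * B)"
    and "(entry_sum B)\<^sup>2 \<le> (real n)\<^sup>2 * mat_trace (B * B)"
proof -
  have s: "B $$ (i, j) = B $$ (j, i)" if "i < n" "j < n" for i j
    using that B sym by (metis carrier_matD index_transpose_mat(1))
  define r where "r k = (\<Sum>j<n. B $$ (k, j))" for k
  have e: "entry_sum B = (\<Sum>k<n. r k)" using B by (simp add: entry_sum_def r_def)
  \<comment> \<open>Cauchy--Schwarz over the row sums; the second bound applies it again within each row.\<close>
  have cs: "(entry_sum B)\<^sup>2 \<le> real n * (\<Sum>k<n. (r k)\<^sup>2)"
    unfolding e using sum_squared_le_sum_of_squares[of r "{..<n}"] by (simp add: mult.commute)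
  have "entry_sum (B * B) = (\<Sum>i<n. \<Sum>j<n. \<Sum>k<n. B $$ (i, k) * B $$ (k, j))"
    using B by (simp add: entry_sum_def index_mult_mat_sum[OF B B] del: index_mult_mat(1))
  also have "\<dots> = (\<Sum>i<n. \<Sum>k<n. \<Sum>j<n. B $$ (i, k) * B $$ (k, j))"
    by (intro sum.cong refl sum.swap)
  also have "\<dots> = (\<Sum>k<n. \<Sum>i<n. \<Sum>j<n. B $$ (i, k) * B $$ (k, j))"
    by (rule sum.swap)
  also have "\<dots> = (\<Sum>k<n. (r k)\<^sup>2)"
    unfolding r_def power2_eq_square sum_product by (intro sum.cong refl) (simp add: s)
  finally show "(entry_sum B)\<^sup>2 \<le> real n * entry_sum (B * B)" using cs by simp
  have "(\<Sum>k<n. (r k)\<^sup>2) \<le> (\<Sum>k<n. real n * (\<Sum>j<n. (B $$ (k, j))\<^sup>2))"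
    unfolding r_def
    using sum_squared_le_sum_of_squares[of _ "{..<n}"] by (intro sum_mono) (simp add: mult.commute)
  also have "\<dots> = real n * (\<Sum>k<n. \<Sum>j<n. (B $$ (k, j))\<^sup>2)" by (simp add: sum_distrib_left)
  also have "(\<Sum>k<n. \<Sum>j<n. (B $$ (k, j))\<^sup>2) = mat_trace (B * B)"
    using B by (simp add: mat_trace_def index_mult_mat_sum[OF B B] s power2_eq_square del: index_mult_mat(1))
  finally have "real n * (\<Sum>k<n. (r k)\<^sup>2) \<le> real n * (real n * mat_trace (B * B))"
    by (intro mult_left_mono) auto
  with cs show "(entry_sum B)\<^sup>2 \<le> (real n)\<^sup>2 * mat_trace (B * B)"
    by (simp add: power2_eq_square mult_ac)
qed

lemma pow_mat_add:
  fixes A :: "'a :: semiring_1 mat"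
  assumes A: "A \<in> carrier_mat n n"
  shows "A ^\<^sub>m (p + q) = A ^\<^sub>m p * A ^\<^sub>m q"
proof (induction q)
  case (Suc q)
  then show ?case using A by (simp add: assoc_mult_mat[of _ n n _ n _ n])
qed (use A in simp)

lemma transpose_pow_mat_symmetric:
  fixes A :: "'a :: comm_semiring_1 mat"
  assumes A: "A \<in> carrier_mat n n" and sym: "A\<^sup>T = A"
  shows "(A ^\<^sub>m p)\<^sup>T = A ^\<^sub>m p"
proof (induction p)
  case (Suc p)
  have "(A ^\<^sub>m Suc p)\<^sup>T = A ^\<^sub>m 1 * A ^\<^sub>m p"
    using A Suc sym by (simp add: transpose_mult[of _ n n _ n])
  then show ?case using pow_mat_add[OF A, of 1 p] by simp
qed (use A in simp)

text \<open>
  A constant factor does not survive taking \<open>N\<close>-th roots for \<open>N \<rightarrow> \<infinity>\<close>. Only the powers of two are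
  needed, which are the exponents that repeated squaring of a matrix provides.
\<close>

lemma le_of_powers_le:
  fixes x a c :: real
  assumes "a \<ge> 0" and "\<And>s. x ^ (2 ^ Suc s) \<le> c * a ^ (2 ^ Suc s)"
  shows "x \<le> a"
proof (rule ccontr)
  assume "\<not> x \<le> a"
  then have xa: "x > a" by simp
  have "a \<noteq> 0"
    using assms(2)[of 0] xa by auto
  then have a: "a > 0" using assms(1) by simp
  then have "x / a > 1" using xa by simp
  then obtain s where s: "c < (x / a) ^ s" using real_arch_pow by blast
  have "s \<le> 2 ^ Suc s" by (meson lessI less_exp less_imp_le order_trans)
  then have "(x / a) ^ s \<le> (x / a) ^ (2 ^ Suc s)"
    using \<open>x / a > 1\<close> by (intro power_increasing) auto
  then have "c < (x / a) ^ (2 ^ Suc s)" using s by simp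
  then have "c * a ^ (2 ^ Suc s) < x ^ (2 ^ Suc s)"
    using a by (simp add: power_divide less_divide_eq del: power_Suc)
  then show False using assms(2)[of s] by simp
qed

text \<open>
  This is the bound on the Rayleigh quotient of the all-ones vector by the spectral radius. It is
  obtained from traces alone, without diagonalizing \<open>A\<close>. Let \<open>x\<close> be the average row sum and let
  \<open>S N\<close> be the entry sum of \<open>A\<^sup>N\<close>. For \<open>N = 2\<^sup>s\<close>, repeated squaring with the first Cauchy--Schwarz
  bound gives \<open>x\<^sup>N \<le> S N / n\<close>. The second one bounds \<open>(S N / n)\<^sup>2\<close> by the trace of \<open>A\<close> to the power
  \<open>2 N\<close>, which is at most \<open>n a\<^sup>2\<^sup>N\<close>. The factor \<open>n\<close> disappears in the limit.
\<close>

lemma entry_sum_le: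
  assumes A: "A \<in> carrier_mat n n" and sym: "A\<^sup>T = A" and n: "n > 0"
    and bd: "\<And>i. i < n \<Longrightarrow> \<bar>eigenvalues_desc A ! i\<bar> \<le> a"
  shows "entry_sum A \<le> real n * a"
proof (cases "entry_sum A \<ge> 0")
  case True
  define x where "x = entry_sum A / real n"
  have x: "x \<ge> 0" using True by (simp add: x_def)
  have a: "a \<ge> 0" using bd[of 0] n by linarith
  have dbl: "A ^\<^sub>m (2 ^ Suc s) = A ^\<^sub>m (2 ^ s) * A ^\<^sub>m (2 ^ s)" for s
    using pow_mat_add[OF A, of "2 ^ s" "2 ^ s"] by (simp add: mult_2)
  have c: "A ^\<^sub>m p \<in> carrier_mat n n" for p using A by simp
  note sq = entry_sum_square_le[OF c transpose_pow_mat_symmetric[OF A sym]]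
  have lower: "x ^ (2 ^ s) \<le> entry_sum (A ^\<^sub>m (2 ^ s)) / real n" for s
  proof (induction s)
    case 0
    then show ?case using A by (simp add: x_def)
  next
    case (Suc s)
    have "x ^ (2 ^ Suc s) = (x ^ (2 ^ s))\<^sup>2" by (simp add: power2_eq_square flip: power_add mult_2)
    also have "\<dots> \<le> (entry_sum (A ^\<^sub>m (2 ^ s)) / real n)\<^sup>2"
      using Suc x by (intro power_mono) auto
    also have "\<dots> \<le> entry_sum (A ^\<^sub>m (2 ^ Suc s)) / real n"
      using sq(1)[of "2 ^ s"] n unfolding dbl
      by (simp add: power_divide power2_eq_square field_simps)
    finally show ?case .
  qed
  have "x ^ (2 ^ Suc s) \<le> real n * a ^ (2 ^ Suc s)" for s
  proof -
    have "x ^ (2 ^ Suc s) = (x ^ (2 ^ s))\<^sup>2" by (simp add: power2_eq_square flip: power_add mult_2)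
    also have "\<dots> \<le> (entry_sum (A ^\<^sub>m (2 ^ s)) / real n)\<^sup>2"
      using lower x by (intro power_mono) auto
    also have "\<dots> \<le> mat_trace (A ^\<^sub>m (2 ^ Suc s))"
      using sq(2)[of "2 ^ s"] n unfolding dbl
      by (simp add: power_divide field_simps)
    also have "\<dots> = (\<Sum>i<n. (eigenvalues_desc A ! i) ^ (2 ^ Suc s))"
      by (rule mat_trace_pow_eigenvalues_desc[OF A sym])
    also have "\<dots> \<le> (\<Sum>i<n. a ^ (2 ^ Suc s))"
    proof (intro sum_mono)
      fix i assume "i \<in> {..<n}"
      then have "\<bar>eigenvalues_desc A ! i\<bar> ^ (2 ^ Suc s) \<le> a ^ (2 ^ Suc s)"
        using bd by (intro power_mono) auto
      then show "(eigenvalues_desc A ! i) ^ (2 ^ Suc s) \<le> a ^ (2 ^ Suc s)"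
        by (simp add: power_even_abs)
    qed
    finally show ?thesis by simp
  qed
  from le_of_powers_le[OF a this] show ?thesis using n by (simp add: x_def field_simps)
next
  case False
  moreover have "a \<ge> 0" using bd[of 0] n by linarith
  ultimately show ?thesis by (smt (verit) mult_nonneg_nonneg of_nat_0_le_iff)
qed

section \<open>Closed walks and odd cycles\<close>

text \<open>
  A closed walk that repeats an inner vertex splits into two shorter closed walks, and if its length
  is odd, so is one of theirs.
\<close>

lemma (in wf_digraph) odd_closed_awalk_imp_odd_cycle:
  assumes "awalk u p u" "odd (length p)"
  shows "\<exists>c. cycle c \<and> odd (length c) \<and> length c \<le> length p"
  using assms
proof (induction "length p" arbitrary: u p rule: less_induct)
  case less
  show ?case
  proof (cases "distinct (tl (awalk_verts u p))")
    case True
    then have "cycle p" using less.prems by (auto simp: cycle_def)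
    then show ?thesis using less.prems by blast
  next
    case False
    \<comment> \<open>The first arc is split off because the start vertex also ends the walk. The repetition to be
      cut at has to be one among the remaining vertices.\<close>
    then obtain e es where p: "p = e # es" by (cases p) auto
    with False less.prems have "awalk (head G e) es u" "\<not> distinct (awalk_verts (head G e) es)"
      and e: "awalk u [e] (head G e)"
      by (auto simp: awalk_Cons_iff awalk_Nil_iff)
    from awalk_not_distinct_decomp[OF this(1,2)] obtain q r s w where es: "es = q @ r @ s"
      and w: "awalk (head G e) q w" "awalk w r w" "awalk w s u" and r: "length r > 0"
      by auto
    have qs: "awalk u ([e] @ q @ s) u" using e w by (intro awalk_appendI)
    show ?thesis
    proof (cases "odd (length r)")
      case True
      then show ?thesis using less.hyps[OF _ w(2)] by (fastforce simp: p es)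
    next
      case False
      then show ?thesis using less.hyps[OF _ qs] less.prems r by (fastforce simp: p es)
    qed
  qed
qed

lemma (in wf_digraph) awalk_of_adjacency_matrix_pow:
  assumes vs: "set vs = verts G"
  shows "i < length vs \<Longrightarrow> j < length vs \<Longrightarrow> (adjacency_matrix G vs ^\<^sub>m l) $$ (i, j) \<noteq> 0
    \<Longrightarrow> \<exists>p. awalk (vs ! i) p (vs ! j) \<and> length p = l"
proof (induction l arbitrary: j)
  case 0
  then have "i = j" by (auto simp: adjacency_matrix_def split: if_splits)
  moreover have "vs ! i \<in> verts G" using 0(1) vs nth_mem by blast
  ultimately show ?case by (intro exI[of _ "[]"]) (simp add: awalk_Nil_iff)
next
  case (Suc l)
  let ?A = "adjacency_matrix G vs" and ?n = "length vs"
  have A: "?A \<in> carrier_mat ?n ?n" by (simp add: adjacency_matrix_def)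
  have "(\<Sum>k<?n. (?A ^\<^sub>m l) $$ (i, k) * ?A $$ (k, j)) \<noteq> 0"
    using Suc.prems A by (simp add: index_mult_mat_sum[of _ ?n] del: index_mult_mat(1))
  then obtain k where k: "k < ?n" "(?A ^\<^sub>m l) $$ (i, k) \<noteq> 0" "?A $$ (k, j) \<noteq> 0"
    by (auto elim: sum.not_neutral_contains_not_neutral)
  obtain p where p: "awalk (vs ! i) p (vs ! k)" "length p = l" using Suc.IH k Suc.prems by blast
  have "(vs ! k, vs ! j) \<in> arcs_ends G"
    using k Suc.prems by (auto simp: adjacency_matrix_def split: if_splits)
  then obtain e where "e \<in> arcs G" "tail G e = vs ! k" "head G e = vs ! j"
    by (auto simp: arcs_ends_conv)
  then have "awalk (vs ! k) [e] (vs ! j)" by (metis arc_implies_awalk)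
  then have "awalk (vs ! i) (p @ [e]) (vs ! j)" using p by (intro awalk_appendI)
  then show ?case using p(2) by (metis length_append_singleton)
qed

lemma (in wf_digraph) mat_trace_adjacency_matrix_odd_pow:
  assumes vs: "set vs = verts G" and l: "odd l" "enat l < odd_girth G"
  shows "mat_trace (adjacency_matrix G vs ^\<^sub>m l) = 0"
proof -
  have "(adjacency_matrix G vs ^\<^sub>m l) $$ (i, i) = 0" if i: "i < length vs" for i
  proof (rule ccontr)
    assume "(adjacency_matrix G vs ^\<^sub>m l) $$ (i, i) \<noteq> 0"
    then obtain p where "awalk (vs ! i) p (vs ! i)" "length p = l"
      using awalk_of_adjacency_matrix_pow[OF vs i i] by blast
    then obtain c where c: "cycle c" "odd (length c)" "length c \<le> l"
      using odd_closed_awalk_imp_odd_cycle l(1) by blast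
    then have "odd_girth G \<le> enat (length c)" unfolding odd_girth_def by (intro INF_lower) auto
    also have "\<dots> \<le> enat l" using c(3) by simp
    finally show False using l(2) by simp
  qed
  then show ?thesis by (simp add: mat_trace_def adjacency_matrix_def)
qed

lemma (in graph) adjacency_matrix_symmetric:
  "(adjacency_matrix G vs)\<^sup>T = adjacency_matrix G vs"
  by (intro eq_matI) (auto simp: adjacency_matrix_def intro: arcs_ends_symmetric[OF sym_arcs])

lemma (in graph) mat_trace_adjacency_matrix_square:
  "mat_trace (adjacency_matrix G vs ^\<^sub>m 2) = entry_sum (adjacency_matrix G vs)"
proof -
  let ?A = "adjacency_matrix G vs" and ?n = "length vs"
  have A: "?A \<in> carrier_mat ?n ?n" by (simp add: adjacency_matrix_def)
  have "?A ^\<^sub>m 2 = ?A * ?A" using A by (simp add: numeral_2_eq_2)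
  moreover have "mat_trace (?A * ?A) = (\<Sum>i<?n. \<Sum>k<?n. ?A $$ (i, k) * ?A $$ (k, i))"
    using A by (simp add: mat_trace_def index_mult_mat_sum[OF A A] del: index_mult_mat(1))
  moreover have "\<dots> = (\<Sum>i<?n. \<Sum>k<?n. ?A $$ (i, k))"
    by (intro sum.cong refl) (auto simp: adjacency_matrix_def intro: arcs_ends_symmetric[OF sym_arcs])
  ultimately show ?thesis using A by (simp add: entry_sum_def)
qed

section \<open>The extreme eigenvalues of a graph of large odd girth\<close>

lemma eigenvalues_desc_antimono:
  assumes "i \<le> j" "j < length (eigenvalues_desc A)"
  shows "eigenvalues_desc A ! j \<le> eigenvalues_desc A ! i"
proof -
  have "sorted (rev (eigenvalues_desc A))" by (simp add: eigenvalues_desc_def)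
  then show ?thesis using assms by (simp add: sorted_rev_iff_nth_mono)
qed

theorem proposition1p5:
  fixes G :: "('a, 'b) pre_digraph" and vs :: "'a list" and n k :: nat
  assumes "k \<ge> 100" and "odd k"
    and "graph G" and "card (verts G) = n" and "n \<ge> 1"
    and "distinct vs" and "set vs = verts G"
    and "odd_girth G \<ge> enat k"
    and "graph_eigenvalue G vs 1 \<ge> real n / real k ^ 3"
  shows "(graph_eigenvalue G vs 1 + graph_eigenvalue G vs n) / real n
           \<le> 4 / real k ^ 2 * (graph_eigenvalue G vs 1 / real n)
              * (ln (2 * real n / graph_eigenvalue G vs 1)) ^ 2"
proof -
  interpret graph G by fact
  define A where "A = adjacency_matrix G vs"
  define x where "x i = eigenvalues_desc A ! i" for i
  define a where "a = x 0"
  define b where "b = - x (n - 1)"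
  define L where "L = ln (2 * real n / a)"
  have len: "length vs = n" using assms(4,6,7) distinct_card by force
  have A: "A \<in> carrier_mat n n" by (simp add: A_def adjacency_matrix_def len)
  have sym: "A\<^sup>T = A" unfolding A_def by (rule adjacency_matrix_symmetric)
  have ev: "graph_eigenvalue G vs 1 = a" "graph_eigenvalue G vs n = - b"
    by (auto simp: graph_eigenvalue_def a_def b_def x_def A_def)
  have anti: "x j \<le> x i" if "i \<le> j" "j < n" for i j
    using eigenvalues_desc_antimono[of i j A] length_eigenvalues_desc[OF A sym] that
    by (simp add: x_def)
  have upper: "x i \<le> a" and lower: "- b \<le> x i" if "i < n" for i
    using anti[of 0 i] anti[of i "n - 1"] that by (auto simp: a_def b_def)
  have "real n / real k ^ 3 > 0" using assms(1,5) by simp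
  then have a: "a > 0" using assms(9) unfolding ev by linarith
  have odd_sums: "(\<Sum>i<n. x i ^ l) = 0" if "odd l" "l < k" for l
  proof -
    have "enat l < odd_girth G" using that assms(8) by (meson enat_ord_simps(2) less_le_trans)
    then have "mat_trace (A ^\<^sub>m l) = 0"
      unfolding A_def using mat_trace_adjacency_matrix_odd_pow[OF assms(7) that(1)] by simp
    then show ?thesis using mat_trace_pow_eigenvalues_desc[OF A sym, of l] by (simp add: x_def)
  qed
  \<comment> \<open>The trace of \<open>A\<close> is zero, so a positive eigenvalue forces a negative one.\<close>
  have b: "b > 0"
  proof (rule ccontr)
    assume "\<not> b > 0"
    then have nn: "x i \<ge> 0" if "i < n" for i using lower[OF that] by simp
    have "x 0 \<le> (\<Sum>i<n. x i)" using assms(5) nn by (intro member_le_sum) auto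
    then show False using odd_sums[of 1] a assms(1) by (simp add: a_def)
  qed
  have "a - b \<le> 4 / real k ^ 2 * a * L\<^sup>2"
  proof (cases "b \<le> a")
    case True
    \<comment> \<open>The largest odd number with \<open>m + 2 < k\<close>: the weight \<open>x\<^sup>2\<close> raises the degree by two.\<close>
    define m where "m = k - 4"
    have m: "odd m" "m + 2 < k" "m > 0" "real k \<le> 2 * real m"
      using assms(1,2) by (auto simp: m_def)
    have "\<bar>x i\<bar> \<le> a" if "i < n" for i using upper[OF that] lower[OF that] True by linarith
    then have "entry_sum A \<le> real n * a"
      using assms(5) by (intro entry_sum_le[OF A sym]) (auto simp: x_def)
    then have "(\<Sum>i<n. (x i)\<^sup>2) \<le> real n * x 0"
      using mat_trace_pow_eigenvalues_desc[OF A sym, of 2] mat_trace_adjacency_matrix_square[of vs]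
      by (simp add: x_def A_def a_def)
    then have "chebyshev m (x 0 / b) \<le> real n / x 0"
      using m a b lower assms(5)
      by (intro chebyshev_le_of_odd_power_sums[where n = n and x = x]) (auto simp: a_def intro: odd_sums)
    then have "a - b \<le> a * (L / real m)\<^sup>2"
      using gap_le_of_chebyshev_le[OF b True m(3), of "real n / a"] by (simp add: a_def L_def)
    also have "\<dots> \<le> a * (2 * L / real k)\<^sup>2"
    proof -
      have "\<bar>L\<bar> / real m \<le> 2 * \<bar>L\<bar> / real k"
        using m(3,4) assms(1) mult_left_mono[OF m(4), of "\<bar>L\<bar>"] by (simp add: field_simps)
      then have "\<bar>L / real m\<bar> \<le> \<bar>2 * L / real k\<bar>" by (simp add: abs_mult)
      then have "(L / real m)\<^sup>2 \<le> (2 * L / real k)\<^sup>2" by (simp only: abs_le_square_iff)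
      then show ?thesis using a by (intro mult_left_mono) auto
    qed
    also have "\<dots> = 4 / real k ^ 2 * a * L\<^sup>2" by (simp add: power_divide power_mult_distrib)
    finally show ?thesis .
  next
    case False
    moreover have "0 \<le> 4 / real k ^ 2 * a * L\<^sup>2" using a by simp
    ultimately show ?thesis by linarith
  qed
  then have "(a - b) / real n \<le> 4 / real k ^ 2 * a * L\<^sup>2 / real n" by (intro divide_right_mono) auto
  then show ?thesis unfolding ev L_def by simp
qed

end
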